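(* Let $P_n$ be the path on $n$ vertices and $k$ a positive integer with $k\ge\chi(P_n)$ and $n\ge k+1$. Then the strong $k$-colour graph $S_k(P_n)$ is connected if and only if $k\ge 3$, $n\ge 5$ and $n\ge k+1$.
   Context: A proper $k$-colouring of a graph $G$ is a map $V(G)\to\{1,\dots,k\}$ giving adjacent vertices different colours; it is strong if all $k$ colours appear. The strong $k$-colour graph $S_k(G)$ has the strong $k$-colourings of $G$ as vertices, two being adjacent iff they differ in colour on exactly one vertex of $G$. *)

theory Defs
  imports "Graph_Theory.Digraph_Component" "HOL-Library.FuncSet"
begin

text \<open>
  A finite simple graph is a \<open>pair_graph\<close>: every edge is represented by its two opposite arcs.
\<close>

text \<open>
  Colourings are extensional functions (value \<open>undefined\<close> off the vertex set), so that two of them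
  are equal iff they agree on the vertices.
\<close>

definition proper_colourings :: "'a pair_pre_digraph \<Rightarrow> nat \<Rightarrow> ('a \<Rightarrow> nat) set" where
  "proper_colourings G k =
     {c \<in> pverts G \<rightarrow>\<^sub>E {1..k}. \<forall>(u, v) \<in> parcs G. c u \<noteq> c v}"

definition strong_colourings :: "'a pair_pre_digraph \<Rightarrow> nat \<Rightarrow> ('a \<Rightarrow> nat) set" where
  "strong_colourings G k = {c \<in> proper_colourings G k. c ` pverts G = {1..k}}"

definition chromatic_number :: "'a pair_pre_digraph \<Rightarrow> nat" where
  "chromatic_number G = (LEAST k. proper_colourings G k \<noteq> {})"

definition strong_colour_graph :: "'a pair_pre_digraph \<Rightarrow> nat \<Rightarrow> ('a \<Rightarrow> nat) pair_pre_digraph" where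
  "strong_colour_graph G k =
     \<lparr> pverts = strong_colourings G k,
       parcs = {(c, d). c \<in> strong_colourings G k \<and> d \<in> strong_colourings G k \<and>
                        (\<exists>!v. v \<in> pverts G \<and> c v \<noteq> d v)} \<rparr>"

definition path_graph :: "nat \<Rightarrow> nat pair_pre_digraph" where
  "path_graph n =
     \<lparr> pverts = {1..n},
       parcs = {(i, j). i \<in> {1..n} \<and> j \<in> {1..n} \<and> (j = i + 1 \<or> i = j + 1)} \<rparr>"

lemma pair_graph_path_graph: "pair_graph (path_graph n)"
proof
  have "parcs (path_graph n) \<subseteq> {1..n} \<times> {1..n}"
    by (auto simp: path_graph_def)
  then show "finite (parcs (path_graph n))"
    by (rule finite_subset) simp
  show "symmetric (path_graph n)"
    by (auto simp: symmetric_def sym_def path_graph_def)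
qed (auto simp: path_graph_def)

lemma pair_graph_strong_colour_graph:
  assumes "finite (pverts G)"
  shows "pair_graph (strong_colour_graph G k)"
proof
  have fin: "finite (strong_colourings G k)"
    by (rule finite_subset[of _ "pverts G \<rightarrow>\<^sub>E {1..k}"])
      (auto simp: strong_colourings_def proper_colourings_def assms intro: finite_PiE)
  then show "finite (pverts (strong_colour_graph G k))"
    by (simp add: strong_colour_graph_def)
  have "parcs (strong_colour_graph G k) \<subseteq> strong_colourings G k \<times> strong_colourings G k"
    by (auto simp: strong_colour_graph_def)
  with fin show "finite (parcs (strong_colour_graph G k))"
    by (meson finite_SigmaI finite_subset)
  have "sym (parcs (strong_colour_graph G k))"
  proof (rule symI)
    fix c d assume "(c, d) \<in> parcs (strong_colour_graph G k)"
    then have cd: "c \<in> strong_colourings G k" "d \<in> strong_colourings G k"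
      and ex: "\<exists>!v. v \<in> pverts G \<and> c v \<noteq> d v"
      unfolding strong_colour_graph_def by auto
    from ex have "\<exists>!v. v \<in> pverts G \<and> d v \<noteq> c v"
      by metis
    with cd show "(d, c) \<in> parcs (strong_colour_graph G k)"
      unfolding strong_colour_graph_def by simp
  qed
  then show "symmetric (strong_colour_graph G k)"
    by (simp add: symmetric_def)
qed (auto simp: strong_colour_graph_def)

end

theory Submission
  imports Defs
begin

text \<open>
  A vertex whose colour is repeated may take any colour absent from its neighbours. Connectedness of
  \<open>S_k(P_n)\<close> for \<open>k \<ge> 3\<close>, \<open>n \<ge> 5\<close>, \<open>n \<ge> k + 1\<close> follows by induction on \<open>n\<close>. If \<open>n \<ge> k + 2\<close>,
  every colouring can be moved to one that is already strong on the first \<open>n - 1\<close> vertices, and a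
  walk in \<open>S_k(P_{n-1})\<close> lifts because the end vertex can always dodge. If \<open>n = k + 1\<close>, every
  colouring can be moved to one where colour \<open>k\<close> occurs only at the end vertex, and a walk in
  \<open>S_{k-1}(P_{n-1})\<close> lifts unchanged. The same two reductions bring \<open>n = 5\<close> down to the
  3-colourings of \<open>P_4\<close>, whose components are represented by the words \<open>abca\<close>; explicit walks on
  five vertices realise a rotation and a transposition of \<open>a, b, c\<close>. Conversely, for \<open>k = 2\<close> and
  for \<open>k = 3\<close>, \<open>n = 4\<close>, the colour of the second vertex never changes.
\<close>

section \<open>Recolouring a single vertex\<close>

abbreviation path_colourings :: "nat \<Rightarrow> nat \<Rightarrow> (nat \<Rightarrow> nat) set" where
  "path_colourings n k \<equiv> strong_colourings (path_graph n) k"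

abbreviation recolourings :: "nat \<Rightarrow> nat \<Rightarrow> ((nat \<Rightarrow> nat) \<times> (nat \<Rightarrow> nat)) set" where
  "recolourings n k \<equiv> parcs (strong_colour_graph (path_graph n) k)"

lemma path_colourings_iff:
  "c \<in> path_colourings n k \<longleftrightarrow>
     (\<forall>i. i \<notin> {1..n} \<longrightarrow> c i = undefined) \<and>
     (\<forall>i. 1 \<le> i \<and> i < n \<longrightarrow> c i \<noteq> c (Suc i)) \<and> c ` {1..n} = {1..k}"
  unfolding strong_colourings_def proper_colourings_def path_graph_def PiE_iff extensional_def
  by (auto simp: Ball_def)

lemma path_colourings_range:
  "c \<in> path_colourings n k \<Longrightarrow> i \<in> {1..n} \<Longrightarrow> c i \<in> {1..k}"
  by (auto simp: path_colourings_iff)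

lemma path_colourings_adjacent:
  "c \<in> path_colourings n k \<Longrightarrow> 1 \<le> i \<Longrightarrow> i < n \<Longrightarrow> c i \<noteq> c (Suc i)"
  by (auto simp: path_colourings_iff)

lemma path_colourings_surj:
  "c \<in> path_colourings n k \<Longrightarrow> x \<in> {1..k} \<Longrightarrow> \<exists>i\<in>{1..n}. c i = x"
  unfolding path_colourings_iff by (metis imageE)

text \<open>The cyclic colouring of period \<open>k\<close>. Its shift \<open>s\<close> will provide
  two colourings that differ at vertex 2.\<close>

lemma path_colourings_nonempty:
  assumes "2 \<le> k" "k \<le> n"
  shows "(\<lambda>i. if i \<in> {1..n} then (i + s) mod k + 1 else undefined) \<in> path_colourings n k"
    (is "?c \<in> _")
proof -
  have "i mod k \<noteq> Suc i mod k" for i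
    using assms by (auto simp: mod_Suc)
  then have adj: "(i + s) mod k \<noteq> (Suc i + s) mod k" for i
    by simp
  have "{1..k} \<subseteq> ?c ` {1..n}"
  proof
    fix x assume x: "x \<in> {1..k}"
    \<comment> \<open>The residue of \<open>x - 1 - s\<close> modulo \<open>k\<close>. If it is 0,
      which is not a vertex, vertex \<open>k\<close> takes its place.\<close>
    define i where "i = (x - 1 + (k - s mod k)) mod k"
    have "(i + s) mod k = (x - 1 + (k - s mod k) + s mod k) mod k"
      unfolding i_def by (metis mod_add_left_eq mod_add_right_eq)
    also have "\<dots> = (x - 1 + k) mod k"
      using assms mod_le_divisor[of k s] by (metis (no_types, lifting) add.assoc le_add_diff_inverse2
          less_le_trans pos2)
    also have "\<dots> = x - 1"
      using x by (subst mod_add_self2) auto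
    finally have i: "(i + s) mod k = x - 1" .
    have "(i + k + s) mod k = x - 1"
      using i by (metis add.commute add.left_commute mod_add_self2)
    moreover have "i < k"
      using assms by (simp add: i_def)
    ultimately show "x \<in> ?c ` {1..n}"
      using i x assms
      by (cases "i = 0") (force intro: rev_image_eqI[of k], force intro: rev_image_eqI[of i])
  qed
  moreover have "?c ` {1..n} \<subseteq> {1..k}"
    using assms by (auto simp: Suc_le_eq)
  ultimately show ?thesis
    using adj by (auto simp: path_colourings_iff)
qed

lemma recolourings_iff:
  "(c, d) \<in> recolourings n k \<longleftrightarrow>
     c \<in> path_colourings n k \<and> d \<in> path_colourings n k \<and> (\<exists>!v. v \<in> {1..n} \<and> c v \<noteq> d v)"
  by (simp add: strong_colour_graph_def path_graph_def)

text \<open>The closure is reflexive so that \<open>x\<close> may be the colour that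
  \<open>i\<close> already has.\<close>

lemma recolouringsI:
  assumes "c \<in> path_colourings n k" "d \<in> path_colourings n k" "i \<in> {1..n}" "d = c(i := x)"
  shows "(c, d) \<in> (recolourings n k)\<^sup>*"
proof (cases "c i = x")
  case True
  then have "d = c"
    using assms(4) by auto
  then show ?thesis by simp
next
  case False
  have "\<exists>!v. v \<in> {1..n} \<and> c v \<noteq> d v"
    unfolding assms(4) using assms(3) False by (intro ex1I[of _ i]) (auto split: if_splits)
  then have "(c, d) \<in> recolourings n k"
    unfolding recolourings_iff using assms(1,2) by blast
  then show ?thesis ..
qed

lemma recolouringsE:
  assumes "(c, d) \<in> recolourings n k"
  obtains v where "c \<in> path_colourings n k" "d \<in> path_colourings n k" "v \<in> {1..n}"
    "c v \<noteq> d v" "d = c(v := d v)"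
proof -
  from assms have cd: "c \<in> path_colourings n k" "d \<in> path_colourings n k"
    and ex: "\<exists>!v. v \<in> {1..n} \<and> c v \<noteq> d v"
    unfolding recolourings_iff by blast+
  from ex obtain v where v: "v \<in> {1..n} \<and> c v \<noteq> d v"
    and only_v: "\<forall>w. w \<in> {1..n} \<and> c w \<noteq> d w \<longrightarrow> w = v"
    by (rule ex1E)
  have "c w = d w" if "w \<noteq> v" for w
  proof (cases "w \<in> {1..n}")
    case True
    then show ?thesis using only_v that by blast
  next
    case False
    then show ?thesis using cd by (simp add: path_colourings_iff)
  qed
  then have "d = c(v := d v)"
    by (intro ext) simp
  then show ?thesis
    by (rule that[OF cd conjunct1[OF v] conjunct2[OF v]])
qed

lemma sym_recolourings: "sym (recolourings n k)"
proof (rule symI)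
  fix c d assume "(c, d) \<in> recolourings n k"
  moreover from this have "\<exists>!v. v \<in> {1..n} \<and> d v \<noteq> c v"
    unfolding recolourings_iff by metis
  ultimately show "(d, c) \<in> recolourings n k"
    unfolding recolourings_iff by blast
qed

lemma recolourings_sym:
  "(c, d) \<in> (recolourings n k)\<^sup>* \<Longrightarrow> (d, c) \<in> (recolourings n k)\<^sup>*"
  by (rule symD[OF sym_rtrancl[OF sym_recolourings]])

text \<open>The duplicate \<open>j\<close> keeps the old colour of \<open>i\<close> in use, so the
  colouring stays strong. The guards on the two neighbours cover the ends of the path.\<close>

lemma recolour:
  assumes c: "c \<in> path_colourings n k"
    and i: "i \<in> {1..n}" and x: "x \<in> {1..k}"
    and dup: "j \<in> {1..n}" "j \<noteq> i" "c j = c i"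
    and left: "1 < i \<Longrightarrow> c (i - 1) \<noteq> x" and right: "i < n \<Longrightarrow> c (Suc i) \<noteq> x"
  shows "c(i := x) \<in> path_colourings n k" "(c, c(i := x)) \<in> (recolourings n k)\<^sup>*"
proof -
  have "{1..k} \<subseteq> (c(i := x)) ` {1..n}"
  proof
    fix y assume "y \<in> {1..k}"
    then obtain l where "l \<in> {1..n}" "c l = y"
      using path_colourings_surj[OF c] by blast
    then show "y \<in> (c(i := x)) ` {1..n}"
      using dup by (intro image_eqI[of _ _ "if l = i then j else l"]) auto
  qed
  moreover have "(c(i := x)) ` {1..n} \<subseteq> {1..k}"
    using path_colourings_range[OF c] x by fastforce
  moreover have "(c(i := x)) l \<noteq> (c(i := x)) (Suc l)" if "1 \<le> l" "l < n" for l
    using that path_colourings_adjacent[OF c that] left right by auto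
  moreover have "(c(i := x)) l = undefined" if "l \<notin> {1..n}" for l
    using that c i unfolding path_colourings_iff by (metis fun_upd_other)
  ultimately show 1: "c(i := x) \<in> path_colourings n k"
    unfolding path_colourings_iff by blast
  show "(c, c(i := x)) \<in> (recolourings n k)\<^sup>*"
    using c 1 i refl by (rule recolouringsI)
qed

lemma ex_other_colour:
  assumes "finite A" "card A < k"
  obtains z :: nat where "z \<in> {1..k}" "z \<notin> A"
proof -
  have "\<not> {1..k} \<subseteq> A"
    using card_mono[OF assms(1), of "{1..k}"] assms(2) by auto
  then show ?thesis
    using that by blast
qed

section \<open>Adding an end vertex\<close>

lemma path_colourings_snoc:
  assumes c: "c \<in> path_colourings n k" and "1 \<le> n" "x \<in> {1..k}" "x \<noteq> c n"
  shows "c(Suc n := x) \<in> path_colourings (Suc n) k"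
proof -
  have "(c(Suc n := x)) ` {1..Suc n} = insert x (c ` {1..n})"
    using \<open>1 \<le> n\<close> by (auto simp: atLeastAtMostSuc_conv)
  then show ?thesis
    using assms by (auto simp: path_colourings_iff less_Suc_eq)
qed

lemma path_colourings_snoc_new:
  assumes c: "c \<in> path_colourings n k" and "1 \<le> n"
  shows "c(Suc n := Suc k) \<in> path_colourings (Suc n) (Suc k)"
proof -
  have "(c(Suc n := Suc k)) ` {1..Suc n} = insert (Suc k) (c ` {1..n})"
    using \<open>1 \<le> n\<close> by (auto simp: atLeastAtMostSuc_conv)
  moreover have "c n \<noteq> Suc k"
    using path_colourings_range[OF c, of n] \<open>1 \<le> n\<close> by auto
  ultimately show ?thesis
    using assms by (auto simp: path_colourings_iff less_Suc_eq)
qed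

lemma path_colourings_butlast:
  assumes c: "c \<in> path_colourings (Suc n) k" and im: "c ` {1..n} = {1..l}"
  shows "c(Suc n := undefined) \<in> path_colourings n l"
proof -
  have "(c(Suc n := undefined)) ` {1..n} = c ` {1..n}"
    by auto
  then show ?thesis
    using c im by (auto simp: path_colourings_iff)
qed

text \<open>A step from \<open>e\<close> to \<open>d\<close> can clash with the end vertex only at
  \<open>n\<close>. So the end vertex first moves to a colour \<open>z\<close> different from
  \<open>e n\<close> and \<open>d n\<close>, which three colours allow; the prefix is strong without
  it. The induction leaves \<open>y\<close> arbitrary so that it can be set to
  \<open>z\<close>.\<close>

lemma recolourings_snoc:
  assumes "(c, d) \<in> (recolourings n k)\<^sup>*" and "c \<in> path_colourings n k" "1 \<le> n" "3 \<le> k"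
    and "x \<in> {1..k}" "x \<noteq> c n" "y \<in> {1..k}" "y \<noteq> d n"
  shows "(c(Suc n := x), d(Suc n := y)) \<in> (recolourings (Suc n) k)\<^sup>*"
  using assms
proof (induction arbitrary: y rule: rtrancl_induct)
  case base
  then show ?case
    by (intro recolouringsI[of _ _ _ _ "Suc n" y] path_colourings_snoc) auto
next
  case (step e d)
  obtain v where v: "e \<in> path_colourings n k" "d \<in> path_colourings n k" "v \<in> {1..n}"
    "d = e(v := d v)"
    using step.hyps(2) by (elim recolouringsE)
  have "card {e n, d n} < k"
    using step.prems card_insert_le_m1[of 2 "{d n}" "e n"] by simp
  then obtain z where z: "z \<in> {1..k}" "z \<notin> {e n, d n}"
    using ex_other_colour by (metis finite.emptyI finite_insert)
  have "(c(Suc n := x), e(Suc n := z)) \<in> (recolourings (Suc n) k)\<^sup>*"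
    using z step.prems by (intro step.IH) auto
  also have "(e(Suc n := z), d(Suc n := z)) \<in> (recolourings (Suc n) k)\<^sup>*"
  proof -
    have d: "d(Suc n := z) = (e(Suc n := z))(v := d v)"
      using v by (metis fun_upd_twist atLeastAtMost_iff Suc_n_not_le_n)
    have "e(Suc n := z) \<in> path_colourings (Suc n) k"
      "d(Suc n := z) \<in> path_colourings (Suc n) k"
      using v z step.prems by (auto intro!: path_colourings_snoc)
    then show ?thesis
      using v(3) d by (intro recolouringsI[of _ _ _ _ v "d v"]) auto
  qed
  also have "(d(Suc n := z), d(Suc n := y)) \<in> (recolourings (Suc n) k)\<^sup>*"
    using z v step.prems
    by (intro recolouringsI[of _ _ _ _ "Suc n" y] path_colourings_snoc) auto
  finally show ?case .
qed

text \<open>Colour \<open>Suc k\<close> never occurs on the first \<open>n\<close> vertices, so the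
  end vertex need not dodge.\<close>

lemma recolourings_snoc_new:
  assumes "(c, d) \<in> (recolourings n k)\<^sup>*" and "1 \<le> n"
  shows "(c(Suc n := Suc k), d(Suc n := Suc k)) \<in> (recolourings (Suc n) (Suc k))\<^sup>*"
  using assms
proof (induction rule: rtrancl_induct)
  case (step e d)
  obtain v where v: "e \<in> path_colourings n k" "d \<in> path_colourings n k" "v \<in> {1..n}"
    "d = e(v := d v)"
    using step.hyps(2) by (elim recolouringsE)
  have "d(Suc n := Suc k) = (e(Suc n := Suc k))(v := d v)"
    using v by (metis fun_upd_twist atLeastAtMost_iff Suc_n_not_le_n)
  then have "(e(Suc n := Suc k), d(Suc n := Suc k)) \<in> (recolourings (Suc n) (Suc k))\<^sup>*"
    using v(1-3) step.prems
    by (intro recolouringsI[of _ _ _ _ v "d v"] path_colourings_snoc_new) auto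
  with step show ?case
    by (meson rtrancl_trans)
qed simp

section \<open>Making the first \<open>n\<close> vertices carry all colours\<close>

lemma ex_repeated:
  fixes c :: "nat \<Rightarrow> nat"
  assumes "card (c ` {1..n}) < n"
  obtains i j where "1 \<le> i" "i < j" "j \<le> n" "c i = c j"
proof -
  have "\<not> inj_on c {1..n}"
    using assms card_image[of c "{1..n}"] by auto
  then obtain i j where "i \<in> {1..n}" "j \<in> {1..n}" "i \<noteq> j" "c i = c j"
    unfolding inj_on_def by auto
  then show ?thesis
    using that[of i j] that[of j i] by (cases i j rule: linorder_cases) auto
qed

text \<open>
  If the colour of the end vertex occurs nowhere else, then some colour is repeated on
  \<open>{1..n}\<close>, and the first of two such vertices may take the colour of the end vertex.
\<close>

lemma ex_recolouring_strong_prefix: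
  assumes c: "c \<in> path_colourings (Suc n) k" and "k \<le> n"
  obtains d where "d \<in> path_colourings (Suc n) k" "(c, d) \<in> (recolourings (Suc n) k)\<^sup>*"
    "d ` {1..n} = {1..k}"
proof (cases "c ` {1..n} = {1..k}")
  case True
  then show ?thesis using c that by blast
next
  case False
  have "insert (c (Suc n)) (c ` {1..n}) = {1..k}"
    using c by (auto simp: path_colourings_iff atLeastAtMostSuc_conv)
  then have new: "c (Suc n) \<notin> c ` {1..n}" and psub: "c ` {1..n} \<subset> {1..k}"
    using False by auto
  then have "card (c ` {1..n}) < n"
    using psubset_card_mono[OF _ psub] \<open>k \<le> n\<close> by simp
  then obtain i j where ij: "1 \<le> i" "i < j" "j \<le> n" "c i = c j"
    using ex_repeated by blast
  have new': "c l \<noteq> c (Suc n)" if "l \<in> {1..n}" for l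
    using new that by (metis imageI)
  \<comment> \<open>Since \<open>i < j\<close> and \<open>j \<le> n\<close>, vertex \<open>i\<close>
    is not adjacent to the end vertex, whose colour it copies.\<close>
  define d where "d = c(i := c (Suc n))"
  have d: "d \<in> path_colourings (Suc n) k" "(c, d) \<in> (recolourings (Suc n) k)\<^sup>*"
    unfolding d_def using ij path_colourings_range[OF c, of "Suc n"]
    by (auto intro!: recolour[OF c, of _ _ j] new')
  have "{1..k} \<subseteq> d ` {1..n}"
  proof
    fix y assume "y \<in> {1..k}"
    then consider "y = c (Suc n)" | l where "l \<in> {1..n}" "y = c l"
      using \<open>insert (c (Suc n)) (c ` {1..n}) = {1..k}\<close> by blast
    then show "y \<in> d ` {1..n}"
    proof cases
      case 1
      then show ?thesis using ij by (auto simp: d_def intro!: image_eqI[of _ _ i])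
    next
      case 2
      then show ?thesis
        using ij by (cases "l = i") (auto simp: d_def intro!: image_eqI[of _ _ j] image_eqI[of _ _ l])
    qed
  qed
  moreover have "d ` {1..n} \<subseteq> {1..k}"
    using path_colourings_range[OF d(1)] by fastforce
  ultimately show ?thesis
    using that d by blast
qed

abbreviation all_recolourable :: "nat \<Rightarrow> nat \<Rightarrow> bool" where
  "all_recolourable n k \<equiv>
     (\<forall>c \<in> path_colourings n k. \<forall>d \<in> path_colourings n k. (c, d) \<in> (recolourings n k)\<^sup>*)"

lemma all_recolourable_Suc_vertices:
  assumes conn: "all_recolourable n k" and "3 \<le> k" "k \<le> n"
  shows "all_recolourable (Suc n) k"
proof (intro ballI)
  fix c d assume c: "c \<in> path_colourings (Suc n) k" and d: "d \<in> path_colourings (Suc n) k"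
  obtain c' where c': "c' \<in> path_colourings (Suc n) k" "(c, c') \<in> (recolourings (Suc n) k)\<^sup>*"
    "c' ` {1..n} = {1..k}"
    using ex_recolouring_strong_prefix[OF c \<open>k \<le> n\<close>] .
  obtain d' where d': "d' \<in> path_colourings (Suc n) k" "(d, d') \<in> (recolourings (Suc n) k)\<^sup>*"
    "d' ` {1..n} = {1..k}"
    using ex_recolouring_strong_prefix[OF d \<open>k \<le> n\<close>] .
  \<comment> \<open>Resetting the end vertex to \<open>undefined\<close> makes the restriction
    extensional on \<open>{1..n}\<close>; updating it again recovers \<open>c'\<close> and
    \<open>d'\<close>.\<close>
  let ?c = "c'(Suc n := undefined)" and ?d = "d'(Suc n := undefined)"
  have cd: "?c \<in> path_colourings n k" "?d \<in> path_colourings n k"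
    using c' d' path_colourings_butlast by blast+
  have "(?c(Suc n := c' (Suc n)), ?d(Suc n := d' (Suc n))) \<in> (recolourings (Suc n) k)\<^sup>*"
    using assms cd path_colourings_range[OF c'(1), of "Suc n"]
      path_colourings_range[OF d'(1), of "Suc n"]
      path_colourings_adjacent[OF c'(1), of n] path_colourings_adjacent[OF d'(1), of n]
    by (intro recolourings_snoc) auto
  then have "(c', d') \<in> (recolourings (Suc n) k)\<^sup>*"
    by simp
  then show "(c, d) \<in> (recolourings (Suc n) k)\<^sup>*"
    using c'(2) recolourings_sym[OF d'(2)] by (meson rtrancl_trans)
qed

section \<open>One vertex more than colours\<close>

text \<open>Deleting either of two equally coloured vertices leaves \<open>k\<close> vertices that
  still carry all \<open>k\<close> colours, so \<open>c\<close> is injective on the rest. Hence any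
  coincidence involves both \<open>i\<close> and \<open>j\<close>.\<close>

lemma repeated_unique:
  assumes c: "c \<in> path_colourings (Suc k) k"
    and ij: "i \<in> {1..Suc k}" "j \<in> {1..Suc k}" "i \<noteq> j" "c i = c j"
    and ab: "a \<in> {1..Suc k}" "b \<in> {1..Suc k}" "a \<noteq> b" "c a = c b"
  shows "{a, b} = {i, j}"
proof -
  have inj: "inj_on c ({1..Suc k} - {j})"
    if "i \<in> {1..Suc k}" "j \<in> {1..Suc k}" "i \<noteq> j" "c i = c j" for i j
  proof (rule eq_card_imp_inj_on)
    have "c ` ({1..Suc k} - {j}) = c ` {1..Suc k}"
    proof -
      have "c j \<in> c ` ({1..Suc k} - {j})"
        using that by (intro image_eqI[of _ _ i]) auto
      then show ?thesis
        using that by (metis image_insert insert_Diff insert_absorb)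
    qed
    then show "card (c ` ({1..Suc k} - {j})) = card ({1..Suc k} - {j})"
      using c that by (simp add: path_colourings_iff)
  qed simp
  have "j \<in> {a, b}"
    using inj[OF ij] ab unfolding inj_on_def by blast
  moreover have "i \<in> {a, b}"
    using inj[of j i] ij ab unfolding inj_on_def by (metis Diff_iff insert_iff singletonD)
  ultimately show ?thesis
    using ij by auto
qed

text \<open>The target is a colouring that becomes a strong one with \<open>k - 1\<close> colours
  once the end vertex is removed. Below, \<open>k\<close> is both the top colour and the neighbour
  of the end vertex \<open>Suc k\<close>.\<close>

definition can_isolate :: "nat \<Rightarrow> (nat \<Rightarrow> nat) \<Rightarrow> bool" where
  "can_isolate k c \<longleftrightarrow> (\<exists>d \<in> path_colourings (Suc k) k.
     (c, d) \<in> (recolourings (Suc k) k)\<^sup>* \<and> d (Suc k) = k \<and> (\<forall>j\<in>{1..k}. d j \<noteq> k))"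

lemma can_isolate_trans:
  "(c, d) \<in> (recolourings (Suc k) k)\<^sup>* \<Longrightarrow> can_isolate k d \<Longrightarrow> can_isolate k c"
  unfolding can_isolate_def by (meson rtrancl_trans)

text \<open>At most one other vertex \<open>p\<close> has the top colour, and with four colours it
  can move to one that is neither the top colour nor on a neighbour.\<close>

lemma can_isolate_end_top:
  assumes c: "c \<in> path_colourings (Suc k) k" and "4 \<le> k" and last: "c (Suc k) = k"
  shows "can_isolate k c"
proof (cases "\<exists>p\<in>{1..k}. c p = k")
  case False
  then show ?thesis
    using c last unfolding can_isolate_def by blast
next
  case True
  then obtain p where p: "p \<in> {1..k}" "c p = k" by blast
  \<comment> \<open>For \<open>p = 1\<close> the value \<open>c 0\<close> is
    \<open>undefined\<close>, which only adds a harmless exclusion.\<close>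
  have "card {k, c (p - 1), c (Suc p)} < k"
    using \<open>4 \<le> k\<close> by (simp add: card_insert_if)
  then obtain z where z: "z \<in> {1..k}" "z \<notin> {k, c (p - 1), c (Suc p)}"
    using ex_other_colour by (metis finite.emptyI finite_insert)
  let ?d = "c(p := z)"
  have "?d \<in> path_colourings (Suc k) k" "(c, ?d) \<in> (recolourings (Suc k) k)\<^sup>*"
    using p z last by (intro recolour[OF c, of _ _ "Suc k"]; auto)+
  moreover have "?d j \<noteq> k" if "j \<in> {1..k}" for j
    using repeated_unique[OF c, of p "Suc k" j "Suc k"] that p z last by (auto simp: doubleton_eq_iff)
  ultimately show ?thesis
    using p last unfolding can_isolate_def by (intro bexI[of _ ?d]) auto
qed

text \<open>Vertex \<open>p\<close> preserves the colour of the end vertex, which may therefore take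
  the top colour, as its neighbour does not have it.\<close>

lemma can_isolate_end_repeated_free:
  assumes c: "c \<in> path_colourings (Suc k) k" and "4 \<le> k"
    and p: "p \<in> {1..k}" "c (Suc k) = c p" and "c k \<noteq> k"
  shows "can_isolate k c"
proof -
  let ?d = "c(Suc k := k)"
  have "?d \<in> path_colourings (Suc k) k" "(c, ?d) \<in> (recolourings (Suc k) k)\<^sup>*"
    using assms by (auto intro!: recolour[OF c, of _ _ p])
  then show ?thesis
    using can_isolate_trans can_isolate_end_top[of ?d k] \<open>4 \<le> k\<close> by auto
qed

text \<open>
  The neighbour \<open>k\<close> of the end vertex blocks the top colour, so that colour is moved to \<open>p\<close>, and
  vertex \<open>k\<close> receives a new colour \<open>z\<close>. The other vertex \<open>q\<close> of colour \<open>z\<close> can then take the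
  colour of the end vertex.
\<close>

lemma can_isolate_end_repeated_far:
  assumes c: "c \<in> path_colourings (Suc k) k" and "4 \<le> k"
    and p: "p \<in> {1..k}" "p + 2 \<le> k" "c (Suc k) = c p" and "c k = k"
  shows "can_isolate k c"
proof -
  have uniq: "{a, b} = {p, Suc k}"
    if "a \<in> {1..Suc k}" "b \<in> {1..Suc k}" "a \<noteq> b" "c a = c b" for a b
    using repeated_unique[OF c, of p "Suc k" a b] that p by auto
  have end_ne: "c (Suc k) \<noteq> k"
    using path_colourings_adjacent[OF c, of k] \<open>4 \<le> k\<close> \<open>c k = k\<close> by auto
  \<comment> \<open>By uniqueness of the repeated pair, vertex \<open>k\<close> alone has the top
    colour, and \<open>p + 2 \<le> k\<close> makes it no neighbour of \<open>p\<close>.\<close>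
  define c1 where "c1 = c(p := k)"
  have "c l \<noteq> k" if "l \<in> {1..k}" "l < k" for l
    using uniq[of l k] that \<open>c k = k\<close> by (auto simp: doubleton_eq_iff)
  then have c1: "c1 \<in> path_colourings (Suc k) k" "(c, c1) \<in> (recolourings (Suc k) k)\<^sup>*"
    unfolding c1_def using p by (intro recolour[OF c, of _ _ "Suc k"]; auto)+
  have "card {k, c1 (k - 1), c (Suc k)} < k"
    using \<open>4 \<le> k\<close> by (simp add: card_insert_if)
  then obtain z where z: "z \<in> {1..k}" "z \<notin> {k, c1 (k - 1), c (Suc k)}"
    using ex_other_colour by (metis finite.emptyI finite_insert)
  define c2 where "c2 = c1(k := z)"
  have c2: "c2 \<in> path_colourings (Suc k) k" "(c1, c2) \<in> (recolourings (Suc k) k)\<^sup>*"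
    unfolding c2_def using p z \<open>c k = k\<close>
    by (intro recolour[OF c1(1), of _ _ p]; simp add: c1_def)+
  obtain q where q: "q \<in> {1..Suc k}" "c1 q = z"
    using path_colourings_surj[OF c1(1) z(1)] by blast
  have "q \<noteq> k" "q \<noteq> Suc k" "q \<noteq> p"
    using q z p \<open>c k = k\<close> by (auto simp: c1_def split: if_splits)
  then have "q < k"
    using q by auto
  \<comment> \<open>Since \<open>p\<close> gave up the end colour, only the end vertex carries it;
    \<open>q < k\<close> is not adjacent to that vertex.\<close>
  have free: "c2 l \<noteq> c (Suc k)" if "l \<in> {1..k}" for l
    using uniq[of l "Suc k"] that z end_ne by (auto simp: c1_def c2_def doubleton_eq_iff)
  have "c2 k = c2 q"
    using q \<open>q < k\<close> by (simp add: c2_def)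
  define c3 where "c3 = c2(q := c (Suc k))"
  have c3: "c3 \<in> path_colourings (Suc k) k" "(c2, c3) \<in> (recolourings (Suc k) k)\<^sup>*"
    unfolding c3_def using \<open>q < k\<close> q(1) free path_colourings_range[OF c, of "Suc k"] \<open>c2 k = c2 q\<close>
    by (intro recolour[OF c2(1), of _ _ k] free; force)+
  have "can_isolate k c3"
    using \<open>4 \<le> k\<close> \<open>q < k\<close> q z p
    by (intro can_isolate_end_repeated_free[OF c3(1), of q]) (auto simp: c3_def c2_def c1_def)
  then show ?thesis
    using c1(2) c2(2) c3(2) can_isolate_trans by blast
qed

text \<open>The case \<open>p = k\<close> contradicts properness. If \<open>p\<close> is next to
  \<open>k\<close>, the repetition is shifted two places left: \<open>p\<close> copies the colour of
  \<open>m = p - 2\<close>, and \<open>m\<close>, now a duplicate, takes the end colour. Then the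
  far case applies.\<close>

lemma can_isolate_end_repeated:
  assumes c: "c \<in> path_colourings (Suc k) k" and "4 \<le> k"
    and p: "p \<in> {1..k}" "c (Suc k) = c p"
  shows "can_isolate k c"
proof -
  consider "c k \<noteq> k" | "c k = k" "p + 2 \<le> k" | "c k = k" "p = k" | "c k = k" "Suc p = k"
    using p by fastforce
  then show ?thesis
  proof cases
    case 1
    then show ?thesis using assms can_isolate_end_repeated_free by blast
  next
    case 2
    then show ?thesis using assms can_isolate_end_repeated_far by blast
  next
    case 3
    then show ?thesis using path_colourings_adjacent[OF c, of k] p by auto
  next
    case 4
    \<comment> \<open>The bound \<open>4 \<le> k\<close> is what makes \<open>k - 3\<close> a
      vertex.\<close>
    then obtain m where m: "p = m + 2" "k = m + 3" "1 \<le> m"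
      using \<open>4 \<le> k\<close> that[of "k - 3"] by linarith
    have uniq: "{a, b} = {p, Suc k}"
      if "a \<in> {1..Suc k}" "b \<in> {1..Suc k}" "a \<noteq> b" "c a = c b" for a b
      using repeated_unique[OF c, of p "Suc k" a b] that p by auto
    define c1 where "c1 = c(p := c m)"
    have "c m \<noteq> c (Suc m)" "c m \<noteq> c k" "c m \<noteq> c (Suc k)"
      using uniq[of m "Suc m"] uniq[of m k] uniq[of m "Suc k"] m
      by (auto simp: doubleton_eq_iff)
    then have c1: "c1 \<in> path_colourings (Suc k) k" "(c, c1) \<in> (recolourings (Suc k) k)\<^sup>*"
      unfolding c1_def using p m path_colourings_range[OF c, of m]
      by (intro recolour[OF c, of _ _ "Suc k"]; force simp: eval_nat_numeral)+
    have free: "c1 l \<noteq> c (Suc k)" if "l \<in> {1..k}" for l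
      using uniq[of l "Suc k"] that \<open>c m \<noteq> c (Suc k)\<close> by (auto simp: c1_def doubleton_eq_iff)
    define c2 where "c2 = c1(m := c (Suc k))"
    have c2: "c2 \<in> path_colourings (Suc k) k" "(c1, c2) \<in> (recolourings (Suc k) k)\<^sup>*"
      unfolding c2_def using m path_colourings_range[OF c, of "Suc k"]
      by (intro recolour[OF c1(1), of _ _ p] free; force simp: c1_def)+
    have "can_isolate k c2"
      using 4 m by (intro can_isolate_end_repeated_far[OF c2(1), of m]) (auto simp: c2_def c1_def)
    then show ?thesis
      using c1(2) c2(2) can_isolate_trans by blast
  qed
qed

text \<open>If the end colour occurs only once, the first vertex of a repeated pair copies it; that
  vertex lies left of \<open>k\<close>, so no conflict with the end vertex arises.\<close>

lemma can_isolate: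
  assumes c: "c \<in> path_colourings (Suc k) k" and "4 \<le> k"
  shows "can_isolate k c"
proof -
  have "card (c ` {1..Suc k}) < Suc k"
    using c by (simp add: path_colourings_iff)
  then obtain i j where ij: "1 \<le> i" "i < j" "j \<le> Suc k" "c i = c j"
    using ex_repeated by blast
  show ?thesis
  proof (cases "\<exists>p\<in>{1..k}. c (Suc k) = c p")
    case True
    then show ?thesis using assms can_isolate_end_repeated by blast
  next
    case False
    then have "j \<noteq> Suc k"
      using ij by (metis atLeastAtMost_iff less_Suc_eq_le)
    let ?d = "c(i := c (Suc k))"
    have ne: "c l \<noteq> c (Suc k)" if "l \<in> {1..k}" for l
      using False that by metis
    have "?d \<in> path_colourings (Suc k) k" "(c, ?d) \<in> (recolourings (Suc k) k)\<^sup>*"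
      using ij \<open>j \<noteq> Suc k\<close> path_colourings_range[OF c, of "Suc k"]
      by (auto intro!: recolour[OF c, of _ _ j] ne)
    then show ?thesis
      using can_isolate_trans can_isolate_end_repeated[of ?d k i] ij \<open>j \<noteq> Suc k\<close> \<open>4 \<le> k\<close> by auto
  qed
qed

text \<open>Isolating the top colour \<open>Suc k\<close> at the end vertex leaves exactly
  \<open>{1..k}\<close> on the others; \<open>3 \<le> k\<close> supplies the four colours needed for
  that.\<close>

lemma ex_recolouring_new_end:
  assumes c: "c \<in> path_colourings (Suc (Suc k)) (Suc k)" and "3 \<le> k"
  obtains d where "d \<in> path_colourings (Suc k) k"
    "(c, d(Suc (Suc k) := Suc k)) \<in> (recolourings (Suc (Suc k)) (Suc k))\<^sup>*"
proof -
  obtain d where d: "d \<in> path_colourings (Suc (Suc k)) (Suc k)"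
    "(c, d) \<in> (recolourings (Suc (Suc k)) (Suc k))\<^sup>*"
    "d (Suc (Suc k)) = Suc k" "\<forall>j\<in>{1..Suc k}. d j \<noteq> Suc k"
    using can_isolate[OF c] \<open>3 \<le> k\<close> unfolding can_isolate_def by auto
  have "insert (Suc k) (d ` {1..Suc k}) = insert (Suc k) {1..k}"
    using d(1,3) unfolding path_colourings_iff
    by (metis atLeastAtMostSuc_conv image_insert le_add1 plus_1_eq_Suc)
  then have "d ` {1..Suc k} = {1..k}"
    using d(4) by (metis (no_types, lifting) Suc_n_not_le_n atLeastAtMost_iff image_iff
        insert_ident)
  then have "d(Suc (Suc k) := undefined) \<in> path_colourings (Suc k) k"
    using d(1) path_colourings_butlast by blast
  then show ?thesis
    using d(2,3) by (intro that) (auto simp: fun_upd_idem)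
qed

lemma all_recolourable_Suc_both:
  assumes conn: "all_recolourable (Suc k) k" and "3 \<le> k"
  shows "all_recolourable (Suc (Suc k)) (Suc k)"
proof (intro ballI)
  fix c d
  assume "c \<in> path_colourings (Suc (Suc k)) (Suc k)" "d \<in> path_colourings (Suc (Suc k)) (Suc k)"
  then obtain c' d' where c': "c' \<in> path_colourings (Suc k) k"
    "(c, c'(Suc (Suc k) := Suc k)) \<in> (recolourings (Suc (Suc k)) (Suc k))\<^sup>*"
    and d': "d' \<in> path_colourings (Suc k) k"
    "(d, d'(Suc (Suc k) := Suc k)) \<in> (recolourings (Suc (Suc k)) (Suc k))\<^sup>*"
    using ex_recolouring_new_end[OF _ \<open>3 \<le> k\<close>] by metis
  have "(c'(Suc (Suc k) := Suc k), d'(Suc (Suc k) := Suc k))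
      \<in> (recolourings (Suc (Suc k)) (Suc k))\<^sup>*"
    using conn c'(1) d'(1) by (intro recolourings_snoc_new) auto
  then show "(c, d) \<in> (recolourings (Suc (Suc k)) (Suc k))\<^sup>*"
    using c'(2) recolourings_sym[OF d'(2)] by (meson rtrancl_trans)
qed

section \<open>Paths on five vertices\<close>

text \<open>Words turn explicit walks into lists that the simplifier can check. Vertices count from
  1 and list positions from 0.\<close>

definition word :: "nat list \<Rightarrow> nat \<Rightarrow> nat" where
  "word xs = (\<lambda>i. if i \<in> {1..length xs} then xs ! (i - 1) else undefined)"

text \<open>Recursive, so that it evaluates on words whose letters are variables known to be
  distinct.\<close>

fun differ_once :: "'a list \<Rightarrow> 'a list \<Rightarrow> bool" where
  "differ_once (x # xs) (y # ys) = (if x = y then differ_once xs ys else xs = ys)"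
| "differ_once _ _ = False"

lemma differ_once_imp_update: "differ_once xs ys \<Longrightarrow> \<exists>i<length xs. ys = xs[i := ys ! i]"
  by (induction xs ys rule: differ_once.induct) (auto split: if_splits)

lemma word_update: "i < length xs \<Longrightarrow> word (xs[i := x]) = (word xs)(Suc i := x)"
  by (auto simp: word_def fun_eq_iff nth_list_update)

lemma word_snoc: "(word xs)(Suc (length xs) := x) = word (xs @ [x])"
  by (auto simp: word_def fun_eq_iff nth_append)

lemma word_snoc_4: "(word [a, b, c, d])(Suc 4 := x) = word [a, b, c, d, x]"
  using word_snoc[of "[a, b, c, d]" x] by (simp add: eval_nat_numeral)

lemma word_path_colourings:
  "word xs \<in> path_colourings (length xs) k \<longleftrightarrow> distinct_adj xs \<and> set xs = {1..k}"
proof -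
  have "word xs ` {1..length xs} = (!) xs ` {..<length xs}"
    unfolding image_Suc_lessThan[symmetric] image_image by (auto simp: word_def)
  then have "word xs ` {1..length xs} = set xs"
    by (auto simp: set_conv_nth)
  moreover have "(\<forall>i. 1 \<le> i \<and> i < length xs \<longrightarrow> word xs i \<noteq> word xs (Suc i)) \<longleftrightarrow>
      (\<forall>i. Suc i < length xs \<longrightarrow> word xs (Suc i) \<noteq> word xs (Suc (Suc i)))"
    by (metis One_nat_def Suc_le_D le_add1 plus_1_eq_Suc)
  ultimately show ?thesis
    by (auto simp: path_colourings_iff distinct_adj_conv_nth word_def)
qed

lemma eq_word:
  assumes "c \<in> path_colourings n k"
  shows "c = word (map c [1..<Suc n])"
  using assms by (auto simp: path_colourings_iff word_def fun_eq_iff simp del: upt_Suc)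

text \<open>Each side condition is decided by computation on the list \<open>ws\<close>. The set
  \<open>A\<close> is separate from \<open>{1..k}\<close> so that it can be given by letters, such
  as \<open>{a, b, c}\<close>.\<close>

lemma recolourings_chain:
  assumes "A = {1..k}" and "successively differ_once ws" "ws \<noteq> []"
    and "\<forall>w \<in> set ws. length w = n \<and> distinct_adj w \<and> set w = A"
    and "hd ws = v" "last ws = w"
  shows "(word v, word w) \<in> (recolourings n k)\<^sup>*"
  unfolding assms(5,6)[symmetric] using assms(2-4)
proof (induction ws rule: induct_list012)
  case (3 v w ws)
  have valid: "word v \<in> path_colourings n k" "word w \<in> path_colourings n k" "length v = n"
    using 3(5) word_path_colourings[of v k] word_path_colourings[of w k] \<open>A = {1..k}\<close> by auto
  obtain i where i: "i < length v" "w = v[i := w ! i]"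
    using 3(3) differ_once_imp_update by auto
  then have "word w = (word v)(Suc i := w ! i)"
    using word_update by metis
  then have "(word v, word w) \<in> (recolourings n k)\<^sup>*"
    using valid i by (intro recolouringsI[of _ _ _ _ "Suc i"]) auto
  also have "(word w, word (last (w # ws))) \<in> (recolourings n k)\<^sup>*"
    using 3 by simp
  finally show ?case by simp
qed auto

text \<open>The two middle vertices use two colours, so the third colour \<open>a\<close> sits at an
  end. If the other end differs from \<open>a\<close>, its colour is repeated in the middle, and it
  can change to \<open>a\<close>.\<close>

lemma ex_recolouring_4_3:
  assumes r: "r \<in> path_colourings 4 3"
  obtains a b c where "{a, b, c} = {1..3}" "(r, word [a, b, c, a]) \<in> (recolourings 4 3)\<^sup>*"
proof -
  let ?w = "[r 1, r 2, r 3, r 4]"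
  have r_word: "r = word ?w"
    using eq_word[OF r] by (simp add: upt_rec eval_nat_numeral)
  have w: "distinct_adj ?w" "set ?w = {1..3}"
    using r word_path_colourings[of ?w 3] r_word by (simp_all add: eval_nat_numeral)
  obtain a where a: "a \<in> {1..3}" "a \<notin> {r 2, r 3}"
    by (rule ex_other_colour[of "{r 2, r 3}" 3]) (auto simp: card_insert_if)
  have abc: "{a, r 2, r 3} = {1..3}"
  proof (rule card_subset_eq)
    show "{a, r 2, r 3} \<subseteq> {1..3}"
      unfolding w(2)[symmetric] using a w(2) by auto
    show "card {a, r 2, r 3} = card {1..3::nat}"
      using a w(1) by auto
  qed simp
  have "a \<in> set ?w"
    unfolding w(2) by (rule a(1))
  then have "r 1 = a \<or> r 4 = a"
    using a(2) by auto
  moreover have "r 1 \<in> {a, r 2, r 3}" "r 4 \<in> {a, r 2, r 3}"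
    unfolding abc w(2)[symmetric] by simp_all
  ultimately consider "r 1 = a" "r 4 = a" | "r 1 = a" "r 4 = r 2" | "r 1 = r 3" "r 4 = a"
    using w(1) by auto
  then have "(word ?w, word [a, r 2, r 3, a]) \<in> (recolourings 4 3)\<^sup>*"
  proof cases
    case 1
    then show ?thesis by simp
  next
    case 2
    then show ?thesis
      by (intro recolourings_chain[OF abc, of "[?w, [a, r 2, r 3, a]]"])
        (use a(2) w(1) in auto)
  next
    case 3
    then show ?thesis
      by (intro recolourings_chain[OF abc, of "[?w, [a, r 2, r 3, a]]"])
        (use a(2) w(1) in auto)
  qed
  then show ?thesis
    using that abc r_word by metis
qed

text \<open>A 3-cycle and a transposition generate all permutations of three letters: rotations
  settle the even arrangements, and one transposition makes an odd one even.\<close>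

lemma rtrancl_permutations:
  fixes F :: "nat \<Rightarrow> nat \<Rightarrow> nat \<Rightarrow> 'a"
  assumes rot: "\<And>a b c. {a, b, c} = {1..3} \<Longrightarrow> (F a b c, F b c a) \<in> R\<^sup>*"
    and swap: "\<And>a b c. {a, b, c} = {1..3} \<Longrightarrow> (F a b c, F c b a) \<in> R\<^sup>*"
    and abc: "{a, b, c} = {1..3}"
  shows "(F a b c, F 1 2 3) \<in> R\<^sup>*"
proof -
  have three: "{1..3} = {1, 2, 3::nat}"
    by auto
  have r: "(F 2 3 1, F 3 1 2) \<in> R\<^sup>*" "(F 3 1 2, F 1 2 3) \<in> R\<^sup>*"
    by (rule rot; auto)+
  have s: "(F 3 2 1, F 1 2 3) \<in> R\<^sup>*" "(F 1 3 2, F 2 3 1) \<in> R\<^sup>*" "(F 2 1 3, F 3 1 2) \<in> R\<^sup>*"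
    by (rule swap; auto)+
  have "a \<in> {1, 2, 3}" "b \<in> {1, 2, 3}" "c \<in> {1, 2, 3}"
    using abc three by auto
  moreover have "distinct [a, b, c]"
    using abc by (intro card_distinct) simp
  ultimately have "a = 1 \<and> b = 2 \<and> c = 3 \<or> a = 2 \<and> b = 3 \<and> c = 1 \<or> a = 3 \<and> b = 1 \<and> c = 2 \<or>
      a = 3 \<and> b = 2 \<and> c = 1 \<or> a = 1 \<and> b = 3 \<and> c = 2 \<or> a = 2 \<and> b = 1 \<and> c = 3"
    by (elim insertE emptyE; simp)
  then show ?thesis
    using r s rtrancl_trans[OF r] rtrancl_trans[OF s(3) r(2)]
      rtrancl_trans[OF s(2) rtrancl_trans[OF r]] by (elim disjE conjE; simp)
qed

lemma all_recolourableI: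
  assumes "\<And>c. c \<in> path_colourings n k \<Longrightarrow> (c, w) \<in> (recolourings n k)\<^sup>*"
  shows "all_recolourable n k"
proof (intro ballI)
  fix c d assume "c \<in> path_colourings n k" "d \<in> path_colourings n k"
  then show "(c, d) \<in> (recolourings n k)\<^sup>*"
    by (rule rtrancl_trans[OF assms recolourings_sym[OF assms]])
qed

lemma all_recolourable_5_3: "all_recolourable 5 3"
proof (rule all_recolourableI)
  fix d assume d: "d \<in> path_colourings 5 3"
  let ?F = "\<lambda>a b c. word [a, b, c, a, b]"
  have distinct: "distinct [a, b, c]" if "{a, b, c} = {1..3}" for a b c :: nat
    using that by (intro card_distinct) simp
  \<comment> \<open>From right to left, each vertex advances one place in the cycle
    \<open>a\<close>, \<open>b\<close>, \<open>c\<close>.\<close>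
  have rot: "(?F a b c, ?F b c a) \<in> (recolourings 5 3)\<^sup>*" if abc: "{a, b, c} = {1..3}" for a b c
    by (intro recolourings_chain[OF abc, of "[[a,b,c,a,b], [a,b,c,a,c], [a,b,c,b,c], [a,b,a,b,c],
        [a,c,a,b,c], [b,c,a,b,c]]"])
      (use distinct[OF abc] in auto)
  have swap: "(?F a b c, ?F c b a) \<in> (recolourings 5 3)\<^sup>*" if abc: "{a, b, c} = {1..3}" for a b c
    by (intro recolourings_chain[OF abc, of "[[a,b,c,a,b], [a,b,c,a,c], [a,b,c,b,c], [a,b,a,b,c],
        [c,b,a,b,c], [c,b,a,b,a], [c,b,a,c,a], [c,b,a,c,b]]"])
      (use distinct[OF abc] in auto)
  have d': "d \<in> path_colourings (Suc 4) 3"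
    using d by simp
  obtain e where e: "e \<in> path_colourings (Suc 4) 3" "(d, e) \<in> (recolourings (Suc 4) 3)\<^sup>*"
    "e ` {1..4} = {1..3}"
    using ex_recolouring_strong_prefix[OF d'] by auto
  let ?r = "e(Suc 4 := undefined)"
  have r: "?r \<in> path_colourings 4 3"
    using path_colourings_butlast[OF e(1,3)] .
  obtain a b c where abc: "{a, b, c} = {1..3}" "(?r, word [a, b, c, a]) \<in> (recolourings 4 3)\<^sup>*"
    using ex_recolouring_4_3[OF r] .
  have "b \<in> {1..3}" "b \<noteq> a"
    using abc(1) distinct by auto
  then have "(?r(Suc 4 := e (Suc 4)), (word [a, b, c, a])(Suc 4 := b)) \<in> (recolourings (Suc 4) 3)\<^sup>*"
    using path_colourings_range[OF e(1), of "Suc 4"] path_colourings_adjacent[OF e(1), of 4]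
    by (intro recolourings_snoc[OF abc(2) r]) (auto simp: word_def)
  then have "(e, ?F a b c) \<in> (recolourings 5 3)\<^sup>*"
    unfolding word_snoc_4 by simp
  moreover have "(d, e) \<in> (recolourings 5 3)\<^sup>*"
    using e(2) by simp
  ultimately have "(d, ?F a b c) \<in> (recolourings 5 3)\<^sup>*"
    by (rule rtrancl_trans[rotated])
  also have "(?F a b c, ?F 1 2 3) \<in> (recolourings 5 3)\<^sup>*"
    using rtrancl_permutations[of ?F, OF rot swap abc(1)] .
  finally show "(d, ?F 1 2 3) \<in> (recolourings 5 3)\<^sup>*" .
qed

text \<open>Again \<open>P_4\<close> with three colours cannot serve as a base. Colour 4 must leave
  the end vertex for a while to let the other letters be permuted.\<close>

lemma all_recolourable_5_4: "all_recolourable 5 4"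
proof (rule all_recolourableI)
  fix d assume d: "d \<in> path_colourings 5 4"
  let ?F = "\<lambda>a b c. word [a, b, c, a, 4]"
  have distinct: "distinct [a, b, c, 4]" "{a, b, c, 4} = {1..4}"
    if "{a, b, c} = {1..3}" for a b c :: nat
  proof -
    have "{a, b, c, 4} = insert 4 {a, b, c}"
      by blast
    also have "\<dots> = {1..4}"
      unfolding that by auto
    finally show "{a, b, c, 4} = {1..4}" .
    then show "distinct [a, b, c, 4]"
      by (intro card_distinct) simp
  qed
  \<comment> \<open>Exactly one colour is repeated at any time. Colour 4 visits vertex 3 here and
    vertex 2 in the transposition below, then returns.\<close>
  have rot: "(?F a b c, ?F b c a) \<in> (recolourings 5 4)\<^sup>*" if abc: "{a, b, c} = {1..3}" for a b c
    by (intro recolourings_chain[OF distinct(2)[OF abc], of "[[a,b,c,a,4], [c,b,c,a,4], [c,b,4,a,4], [c,b,4,a,c],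
        [a,b,4,a,c], [a,b,4,b,c], [a,c,4,b,c], [a,c,4,b,4], [a,c,a,b,4], [b,c,a,b,4]]"])
      (use distinct(1)[OF abc] in auto)
  have swap: "(?F a b c, ?F c b a) \<in> (recolourings 5 4)\<^sup>*" if abc: "{a, b, c} = {1..3}" for a b c
    by (intro recolourings_chain[OF distinct(2)[OF abc], of "[[a,b,c,a,4], [a,b,c,b,4], [a,4,c,b,4], [a,4,c,b,a],
        [c,4,c,b,a], [c,4,a,b,a], [c,4,a,b,4], [c,b,a,b,4], [c,b,a,c,4]]"])
      (use distinct(1)[OF abc] in auto)
  have d': "d \<in> path_colourings (Suc (Suc 3)) (Suc 3)"
    using d by (simp add: eval_nat_numeral)
  obtain r where r: "r \<in> path_colourings (Suc 3) 3"
    "(d, r(Suc (Suc 3) := Suc 3)) \<in> (recolourings (Suc (Suc 3)) (Suc 3))\<^sup>*"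
    using ex_recolouring_new_end[OF d'] by auto
  have "r \<in> path_colourings 4 3"
    using r(1) by simp
  then obtain a b c where abc: "{a, b, c} = {1..3}"
    "(r, word [a, b, c, a]) \<in> (recolourings 4 3)\<^sup>*"
    using ex_recolouring_4_3 by blast
  have "(r(Suc 4 := Suc 3), (word [a, b, c, a])(Suc 4 := Suc 3)) \<in> (recolourings (Suc 4) (Suc 3))\<^sup>*"
    using recolourings_snoc_new[OF abc(2)] by simp
  then have "(r(Suc 4 := Suc 3), ?F a b c) \<in> (recolourings 5 4)\<^sup>*"
    unfolding word_snoc_4 by simp
  moreover have "(d, r(Suc 4 := Suc 3)) \<in> (recolourings 5 4)\<^sup>*"
    using r(2) by simp
  ultimately have "(d, ?F a b c) \<in> (recolourings 5 4)\<^sup>*"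
    by (rule rtrancl_trans[rotated])
  also have "(?F a b c, ?F 1 2 3) \<in> (recolourings 5 4)\<^sup>*"
    using rtrancl_permutations[of ?F, OF rot swap abc(1)] .
  finally show "(d, ?F 1 2 3) \<in> (recolourings 5 4)\<^sup>*" .
qed

section \<open>Induction on the number of vertices\<close>

lemma all_recolourable:
  assumes "5 \<le> n" "3 \<le> k" "k + 1 \<le> n"
  shows "all_recolourable n k"
  using assms
proof (induction n arbitrary: k rule: nat_induct_at_least)
  case base
  then have "k = 3 \<or> k = 4" by auto
  then show ?case
    using all_recolourable_5_3 all_recolourable_5_4 by blast
next
  case (Suc n)
  show ?case
  proof (cases "k + 1 \<le> n")
    case True
    then show ?thesis
      using Suc by (intro all_recolourable_Suc_vertices) auto
  next
    case False
    then have "k = n"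
      using Suc.prems by simp
    \<comment> \<open>With no vertex to spare, one vertex and one colour are removed together;
      \<open>5 \<le> n\<close> keeps \<open>l\<close> at least 3.\<close>
    then obtain l where l: "k = Suc l" "n = Suc l"
      using Suc.hyps by (cases n) auto
    then have "all_recolourable (Suc l) l"
      using Suc by auto
    then show ?thesis
      using Suc.hyps unfolding l by (intro all_recolourable_Suc_both) auto
  qed
qed

section \<open>The remaining cases\<close>

text \<open>If vertex 2 changed, vertices 1 and 3 would avoid both of its colours. This is
  impossible for \<open>k = 2\<close>. For \<open>k = 3\<close> they share the third colour, so
  strongness of \<open>c\<close> and of \<open>d\<close> forces vertex 4 to have the new colour in
  \<open>c\<close> and the old one in \<open>d\<close>, although it is unchanged.\<close>

lemma recolourings_fix_2:
  assumes "(c, d) \<in> recolourings n k" and "k = 2 \<and> 3 \<le> n \<or> k = 3 \<and> n = 4"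
  shows "c 2 = d 2"
proof (rule ccontr)
  assume ne: "c 2 \<noteq> d 2"
  obtain v where v: "c \<in> path_colourings n k" "d \<in> path_colourings n k" "d = c(v := d v)"
    using assms(1) by (elim recolouringsE)
  have other: "d w = c w" if "w \<noteq> v" for w
    using fun_upd_other[OF that, of c "d v"] unfolding v(3)[symmetric] .
  have "v = 2"
    using other[of 2] ne by metis
  then have d: "d 1 = c 1" "d 3 = c 3" "d 4 = c 4"
    using other by simp_all
  have "2 < n"
    using assms(2) by auto
  then have adj: "c 1 \<noteq> c 2" "c 2 \<noteq> c 3" "d 1 \<noteq> d 2" "d 2 \<noteq> d 3"
    using path_colourings_adjacent[OF v(1), of 1] path_colourings_adjacent[OF v(1), of 2]
      path_colourings_adjacent[OF v(2), of 1] path_colourings_adjacent[OF v(2), of 2]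
    by (simp_all flip: numeral_2_eq_2)
  have range: "c 1 \<in> {1..k}" "c 2 \<in> {1..k}" "c 3 \<in> {1..k}" "d 2 \<in> {1..k}"
    using path_colourings_range[OF v(1), of 1] path_colourings_range[OF v(1), of 2]
      path_colourings_range[OF v(1), of 3] path_colourings_range[OF v(2), of 2] \<open>2 < n\<close> by simp_all
  show False
  proof (cases "k = 2")
    case True
    then show False using adj range d ne by auto
  next
    case False
    then have kn: "k = 3" "n = 4" using assms(2) by auto
    have four: "{1..4} = {1, 2, 3, 4::nat}" by auto
    have "c ` {1..4} = {1..k}" "d ` {1..4} = {1..k}"
      using v(1,2) kn(2) unfolding path_colourings_iff by blast+
    then have "d 2 \<in> c ` {1..4}" "c 2 \<in> d ` {1..4}"
      using range by blast+
    moreover have "c 1 = c 3"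
      using adj range d ne kn by auto
    ultimately show False
      using adj d ne unfolding four by auto
  qed
qed

text \<open>The cyclic colourings with shifts 0 and 1 disagree at vertex 2, whose colour is
  invariant.\<close>

lemma not_all_recolourable:
  assumes "k = 2 \<and> 3 \<le> n \<or> k = 3 \<and> n = 4"
  shows "\<not> all_recolourable n k"
proof
  assume conn: "all_recolourable n k"
  let ?c = "\<lambda>s i. if i \<in> {1..n} then (i + s) mod k + 1 else undefined"
  have "?c 0 \<in> path_colourings n k" "?c 1 \<in> path_colourings n k"
    using assms by (intro path_colourings_nonempty; auto)+
  then have "(?c 0, ?c 1) \<in> (recolourings n k)\<^sup>*"
    using conn by blast
  then have "?c 0 2 = ?c 1 2"
    by (induction rule: rtrancl_induct) (auto dest: recolourings_fix_2[OF _ assms])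
  then show False
    using assms by auto
qed

text \<open>The library notion demands a nonempty vertex set and reachability inside it along
  symmetrised arcs. The arcs are already symmetric and join vertices only, so plain reachability
  suffices.\<close>

lemma connected_strong_colour_graph_iff:
  "Digraph_Component.connected (with_proj (strong_colour_graph (path_graph n) k)) \<longleftrightarrow>
     path_colourings n k \<noteq> {} \<and> all_recolourable n k"
proof -
  let ?V = "path_colourings n k" and ?R = "recolourings n k"
  have verts: "pverts (strong_colour_graph (path_graph n) k) = ?V"
    by (simp add: strong_colour_graph_def)
  have "?R\<^sup>s = ?R"
    using sym_recolourings[of n k] by (auto simp: symcl_def dest: symD)
  moreover have "(u, v) \<in> rtrancl_on ?V ?R \<longleftrightarrow> (u, v) \<in> ?R\<^sup>*" if "u \<in> ?V" for u v
  proof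
    assume "(u, v) \<in> ?R\<^sup>*"
    then show "(u, v) \<in> rtrancl_on ?V ?R"
    proof (induction rule: rtrancl_induct)
      case base
      show ?case using that by simp
    next
      case (step y z)
      have "z \<in> ?V"
        using step.hyps(2) by (elim recolouringsE)
      show ?case
        by (rule rtrancl_on_into_rtrancl_on[OF step.IH step.hyps(2) \<open>z \<in> ?V\<close>])
    qed
  qed (rule rtrancl_on_rtranclI)
  ultimately show ?thesis
    by (simp add: connected_conv verts)
qed

lemma chromatic_number_path_graph_ge_2:
  assumes "2 \<le> n"
  shows "2 \<le> chromatic_number (path_graph n)"
proof -
  \<comment> \<open>Existence of some colouring ensures that \<open>LEAST\<close> yields an attained
    value; the edge from 1 to 2 then forces two colours.\<close>
  have "proper_colourings (path_graph n) 2 \<noteq> {}"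
    using path_colourings_nonempty[of 2 n] assms unfolding strong_colourings_def by blast
  then have "proper_colourings (path_graph n) (chromatic_number (path_graph n)) \<noteq> {}"
    unfolding chromatic_number_def by (rule LeastI)
  then obtain c where c: "c \<in> proper_colourings (path_graph n) (chromatic_number (path_graph n))"
    by blast
  then have "c \<in> {1..n} \<rightarrow>\<^sub>E {1..chromatic_number (path_graph n)}"
    by (simp add: proper_colourings_def path_graph_def)
  then have "c 1 \<in> {1..chromatic_number (path_graph n)}" "c 2 \<in> {1..chromatic_number (path_graph n)}"
    using assms by (auto simp: PiE_iff)
  moreover have "(1, 2) \<in> parcs (path_graph n)"
    using assms by (auto simp: path_graph_def)
  then have "c 1 \<noteq> c 2"
    using c unfolding proper_colourings_def by blast
  ultimately show ?thesis
    by auto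
qed

theorem theorem3p3:
  fixes n k :: nat
  assumes "k \<ge> 1"
    and "k \<ge> chromatic_number (path_graph n)"
    and "n \<ge> k + 1"
  shows "Digraph_Component.connected (with_proj (strong_colour_graph (path_graph n) k))
           \<longleftrightarrow> k \<ge> 3 \<and> n \<ge> 5 \<and> n \<ge> k + 1"
proof -
  have "2 \<le> k"
    using chromatic_number_path_graph_ge_2[of n] assms by linarith
  then have "path_colourings n k \<noteq> {}"
    using path_colourings_nonempty[of k n] assms by auto
  moreover have "all_recolourable n k \<longleftrightarrow> 3 \<le> k \<and> 5 \<le> n"
  proof
    assume "all_recolourable n k"
    \<comment> \<open>Given \<open>2 \<le> k\<close> and \<open>k + 1 \<le> n\<close>, these are
      exactly the cases in which \<open>3 \<le> k\<close> or \<open>5 \<le> n\<close> fails.\<close>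
    then have "\<not> (k = 2 \<and> 3 \<le> n \<or> k = 3 \<and> n = 4)"
      using not_all_recolourable by blast
    then show "3 \<le> k \<and> 5 \<le> n"
      using \<open>2 \<le> k\<close> assms(3) by linarith
  qed (use all_recolourable assms(3) in blast)
  ultimately show ?thesis
    using assms(3) by (simp add: connected_strong_colour_graph_iff)
qed

end
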